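(* Let $i$ be a sub-optimal arm ($\Delta_i>0$), let $T$ be the horizon, and let $$L_{1,i}:=\frac{4\left(\sqrt2+\sqrt{3.5}\right)^2\ln\left(T\Delta_i^2+100^{1/3}\right)}{\Delta_i^2}.$$ Let $\tau_s^{(1)}$ be the round when the $s$-th pull of the optimal arm $1$ occurs and let $\theta_{1,s}\sim\mathcal{N}\left(\hat\mu_{1,s},\frac1s\right)$. Then $$\mathbb{E}\left[\frac{1}{\mathbb{P}\left\{\theta_{1,s}>\mu_1-\frac{\Delta_i}{2}\,\middle|\,\mathcal{F}_{\tau_s^{(1)}}\right\}}\right]-1\le 29\quad\text{for all integers } s\ge1,$$ and $$\mathbb{E}\left[\frac{1}{\mathbb{P}\left\{\theta_{1,s}>\mu_1-\frac{\Delta_i}{2}\,\middle|\,\mathcal{F}_{\tau_s^{(1)}}\right\}}\right]-1\le \frac{180}{T\Delta_i^2}\quad\text{for all integers } s\ge L_{1,i}.$$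
   Context: Stochastic $K$-armed bandit: arm $i\in\{1,\dots,K\}$ has a reward distribution $p_i$ supported in $[0,1]$ with mean $\mu_i$; rewards of successive pulls of an arm are i.i.d. from its distribution. Arm $1$ is the unique optimal arm, $\mu_1>\mu_i$ for $i\neq1$, and $\Delta_i:=\mu_1-\mu_i$. $i_t$ is the arm pulled in round $t$ and $X_{i_t}(t)$ the observed reward. $\mathcal{F}_t=\{i_q,X_{i_q}(q):q=1,\dots,t\}$ is the history by the end of round $t$. $\hat\mu_{1,s}$ is the empirical mean of the rewards of the first $s$ pulls of arm $1$, i.e. the average of $s$ i.i.d. draws from $p_1$. $\mathcal{N}(\mu,\sigma^2)$ is the Gaussian distribution with mean $\mu$ and variance $\sigma^2$; conditionally on $\mathcal{F}_{\tau_s^{(1)}}$, $\theta_{1,s}$ is Gaussian with mean $\hat\mu_{1,s}$ and variance $1/s$. The outer expectation is over the history (i.e. over $\hat\mu_{1,s}$). *)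

theory Defs
  imports "HOL-Probability.Probability"
begin

text \<open>
  Arms are numbered \<open>1, \<dots>, K\<close> and rounds \<open>1, 2, \<dots>\<close>. \<open>A t\<close> is the arm pulled in round \<open>t\<close>, and
  \<open>Y i n\<close> is the reward returned by the \<open>n\<close>-th pull of arm \<open>i\<close>. Nothing is assumed about how the
  arms are chosen.
\<close>

definition arm_mean :: "(nat \<Rightarrow> real measure) \<Rightarrow> nat \<Rightarrow> real" where
  "arm_mean p i = (\<integral>x. x \<partial>p i)"

definition gap :: "(nat \<Rightarrow> real measure) \<Rightarrow> nat \<Rightarrow> real" where
  "gap p i = arm_mean p 1 - arm_mean p i"

locale stochastic_bandit = prob_space M
  for M :: "'a measure" and K :: nat and p :: "nat \<Rightarrow> real measure"
    and A :: "nat \<Rightarrow> 'a \<Rightarrow> nat" and Y :: "nat \<Rightarrow> nat \<Rightarrow> 'a \<Rightarrow> real" +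
  assumes prob_space_arm: "i \<in> {1..K} \<Longrightarrow> prob_space (p i)"
    and sets_arm: "i \<in> {1..K} \<Longrightarrow> sets (p i) = sets borel"
    and support_arm: "i \<in> {1..K} \<Longrightarrow> AE x in p i. x \<in> {0..1}"
    and optimal_arm: "i \<in> {1..K} \<Longrightarrow> i \<noteq> 1 \<Longrightarrow> arm_mean p i < arm_mean p 1"
    and measurable_arm: "1 \<le> t \<Longrightarrow> A t \<in> M \<rightarrow>\<^sub>M count_space UNIV"
    and arm_range: "1 \<le> t \<Longrightarrow> \<omega> \<in> space M \<Longrightarrow> A t \<omega> \<in> {1..K}"
    and indep_rewards: "i \<in> {1..K} \<Longrightarrow> indep_vars (\<lambda>_. borel) (Y i) {1..}"
    and distr_reward: "i \<in> {1..K} \<Longrightarrow> 1 \<le> n \<Longrightarrow> distr M borel (Y i n) = p i"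

definition num_pulls :: "(nat \<Rightarrow> 'a \<Rightarrow> nat) \<Rightarrow> nat \<Rightarrow> nat \<Rightarrow> 'a \<Rightarrow> nat" where
  "num_pulls A i t \<omega> = card {q \<in> {1..t}. A q \<omega> = i}"

definition observed_reward ::
    "(nat \<Rightarrow> 'a \<Rightarrow> nat) \<Rightarrow> (nat \<Rightarrow> nat \<Rightarrow> 'a \<Rightarrow> real) \<Rightarrow> nat \<Rightarrow> 'a \<Rightarrow> real" where
  "observed_reward A Y t \<omega> = Y (A t \<omega>) (num_pulls A (A t \<omega>) t \<omega>) \<omega>"

text \<open>
  The sigma-algebra generated by the pulled arms and observed rewards of rounds \<open>1, \<dots>, t\<close>.
  The index ranges over \<^typ>\<open>enat\<close>, as an arm need not be pulled \<open>s\<close> times on every path; index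
  \<open>\<infinity>\<close> gives the whole history.
\<close>

definition history :: "'a measure \<Rightarrow> (nat \<Rightarrow> 'a \<Rightarrow> nat) \<Rightarrow> (nat \<Rightarrow> nat \<Rightarrow> 'a \<Rightarrow> real)
    \<Rightarrow> enat \<Rightarrow> 'a measure" where
  "history M A Y t = vimage_algebra (space M)
     (\<lambda>\<omega>. \<lambda>q\<in>{q. 1 \<le> q \<and> enat q \<le> t}. (A q \<omega>, observed_reward A Y q \<omega>))
     (\<Pi>\<^sub>M q\<in>{q. 1 \<le> q \<and> enat q \<le> t}. count_space UNIV \<Otimes>\<^sub>M borel)"

text \<open>The round of the \<open>s\<close>-th pull of arm \<open>i\<close> (\<open>s \<ge> 1\<close>); it is \<open>\<infinity>\<close> if there is no such round.\<close>

definition pull_time :: "(nat \<Rightarrow> 'a \<Rightarrow> nat) \<Rightarrow> nat \<Rightarrow> nat \<Rightarrow> 'a \<Rightarrow> enat" where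
  "pull_time A i s \<omega> = Inf {enat t | t. 1 \<le> t \<and> A t \<omega> = i \<and> num_pulls A i t \<omega> = s}"

definition history_at_pull :: "'a measure \<Rightarrow> (nat \<Rightarrow> 'a \<Rightarrow> nat) \<Rightarrow> (nat \<Rightarrow> nat \<Rightarrow> 'a \<Rightarrow> real)
    \<Rightarrow> nat \<Rightarrow> nat \<Rightarrow> 'a measure" where
  "history_at_pull M A Y i s =
     filtration.pre_sigma (space M) (history M A Y) (pull_time A i s)"

definition empirical_mean :: "(nat \<Rightarrow> nat \<Rightarrow> 'a \<Rightarrow> real) \<Rightarrow> nat \<Rightarrow> nat \<Rightarrow> 'a \<Rightarrow> real" where
  "empirical_mean Y i s \<omega> = (\<Sum>n=1..s. Y i n \<omega>) / real s"

definition cond_prob_given :: "'a measure \<Rightarrow> 'a measure \<Rightarrow> 'a set \<Rightarrow> 'a \<Rightarrow> ennreal" where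
  "cond_prob_given M F E = nn_cond_exp M F (indicator E)"

text \<open>Conditionally on \<open>F\<close>, \<open>\<theta>\<close> is Gaussian with (random) mean \<open>m\<close> and variance \<open>v > 0\<close>.\<close>

definition cond_normal :: "'a measure \<Rightarrow> 'a measure \<Rightarrow> ('a \<Rightarrow> real) \<Rightarrow> ('a \<Rightarrow> real) \<Rightarrow> real \<Rightarrow> bool"
where
  "cond_normal M F \<theta> m v \<longleftrightarrow>
     \<theta> \<in> borel_measurable M \<and>
     (\<forall>B\<in>sets borel. AE \<omega> in M. cond_prob_given M F {\<omega>\<in>space M. \<theta> \<omega> \<in> B} \<omega>
        = emeasure (density lborel (normal_density (m \<omega>) (sqrt v))) B)"

definition pull_threshold :: "nat \<Rightarrow> real \<Rightarrow> real" where
  "pull_threshold T \<Delta> =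
     4 * (sqrt 2 + sqrt 3.5)\<^sup>2 * ln (real T * \<Delta>\<^sup>2 + 100 powr (1/3)) / \<Delta>\<^sup>2"

text \<open>
  The side conditions under which \<^const>\<open>history_at_pull\<close> and \<^const>\<open>cond_prob_given\<close> are meaningful.
\<close>

lemma space_history [simp]: "space (history M A Y t) = space M"
  by (simp add: history_def)

lemma measurable_history:
  assumes "1 \<le> q" "enat q \<le> t"
  shows "(\<lambda>\<omega>. (A q \<omega>, observed_reward A Y q \<omega>))
    \<in> history M A Y t \<rightarrow>\<^sub>M count_space UNIV \<Otimes>\<^sub>M borel"
proof -
  let ?I = "{q. 1 \<le> q \<and> enat q \<le> t}"
  let ?f = "\<lambda>\<omega>. \<lambda>q\<in>?I. (A q \<omega>, observed_reward A Y q \<omega>)"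
  have "?f \<in> history M A Y t \<rightarrow>\<^sub>M (\<Pi>\<^sub>M q\<in>?I. count_space UNIV \<Otimes>\<^sub>M borel)"
    unfolding history_def
    by (rule measurable_vimage_algebra1) (auto simp: space_PiM space_pair_measure)
  from measurable_compose[OF this measurable_component_singleton[of q]] assms
  show ?thesis by simp
qed

lemma measurable_arm_history:
  assumes "1 \<le> q" "enat q \<le> t"
  shows "A q \<in> history M A Y t \<rightarrow>\<^sub>M count_space UNIV"
  using measurable_compose[OF measurable_history[OF assms] measurable_fst] by simp

lemma sets_history_subset:
  assumes "space N = space M"
    and "\<And>q. 1 \<le> q \<Longrightarrow> enat q \<le> t \<Longrightarrow>
      (\<lambda>\<omega>. (A q \<omega>, observed_reward A Y q \<omega>)) \<in> N \<rightarrow>\<^sub>M count_space UNIV \<Otimes>\<^sub>M borel"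
  shows "sets (history M A Y t) \<subseteq> sets N"
  unfolding history_def assms(1)[symmetric]
  by (rule measurable_iff_sets[THEN iffD1, THEN conjunct2], rule measurable_restrict)
     (use assms(2) in auto)

lemma filtration_history: "filtration (space M) (history M A Y)"
proof
  fix t u :: enat assume "t \<le> u"
  then show "sets (history M A Y t) \<subseteq> sets (history M A Y u)"
    by (intro sets_history_subset measurable_history) auto
qed simp

lemma num_pulls_measurable:
  assumes "\<And>q. 1 \<le> q \<Longrightarrow> q \<le> t \<Longrightarrow> A q \<in> N \<rightarrow>\<^sub>M count_space UNIV"
  shows "num_pulls A i t \<in> N \<rightarrow>\<^sub>M count_space UNIV"
proof -
  have "num_pulls A i t = (\<lambda>\<omega>. \<Sum>q=1..t. if A q \<omega> = i then 1 else 0)"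
    by (auto simp: num_pulls_def fun_eq_iff sum.If_cases Int_def)
  also have "\<dots> \<in> N \<rightarrow>\<^sub>M borel"
  proof (rule borel_measurable_sum)
    fix q assume "q \<in> {1..t}"
    then have [measurable]: "A q \<in> N \<rightarrow>\<^sub>M count_space UNIV" using assms by auto
    show "(\<lambda>\<omega>. if A q \<omega> = i then 1 else 0 :: nat) \<in> N \<rightarrow>\<^sub>M borel" by measurable
  qed
  finally show ?thesis
    by (simp add: measurable_cong_sets[OF refl sets_borel_eq_count_space])
qed

lemma pull_timeD:
  assumes "pull_time A i s \<omega> = enat t"
  shows "1 \<le> t" "A t \<omega> = i" "num_pulls A i t \<omega> = s"
proof -
  let ?S = "{enat t | t. 1 \<le> t \<and> A t \<omega> = i \<and> num_pulls A i t \<omega> = s}"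
  have "Inf ?S = enat t" using assms by (simp add: pull_time_def)
  then have "?S \<noteq> {}" by (auto simp: Inf_enat_def simp del: Collect_empty_eq)
  then have "Inf ?S \<in> ?S" by (metis (no_types, lifting) Inf_enat_def LeastI ex_in_conv)
  then show "1 \<le> t" "A t \<omega> = i" "num_pulls A i t \<omega> = s"
    unfolding \<open>Inf ?S = enat t\<close> by auto
qed

lemma observed_reward_pull_time:
  "pull_time A i n \<omega> = enat t \<Longrightarrow> observed_reward A Y t \<omega> = Y i n \<omega>"
  by (auto simp: observed_reward_def dest: pull_timeD)

lemma stopping_time_pull_time: "stopping_time (history M A Y) (pull_time A i s)"
proof
  fix t
  let ?P = "\<lambda>r \<omega>. 1 \<le> r \<and> enat r \<le> t \<and> A r \<omega> = i \<and> num_pulls A i r \<omega> = s"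
  have le_iff: "pull_time A i s \<omega> \<le> t \<longleftrightarrow> t = \<infinity> \<or> (\<exists>r. ?P r \<omega>)" for \<omega>
  proof
    assume "pull_time A i s \<omega> \<le> t"
    then show "t = \<infinity> \<or> (\<exists>r. ?P r \<omega>)"
      using pull_timeD[of A i s \<omega>] by (cases "pull_time A i s \<omega>") fastforce+
  next
    have "pull_time A i s \<omega> \<le> enat r"
      if "1 \<le> r" "A r \<omega> = i" "num_pulls A i r \<omega> = s" for r
      unfolding pull_time_def by (rule Inf_lower) (use that in auto)
    moreover assume "t = \<infinity> \<or> (\<exists>r. ?P r \<omega>)"
    ultimately show "pull_time A i s \<omega> \<le> t" by (auto intro: order_trans)
  qed
  have "Measurable.pred (history M A Y t) (?P r)" for r
  proof (cases "1 \<le> r \<and> enat r \<le> t")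
    case True
    then have [measurable]: "A r \<in> history M A Y t \<rightarrow>\<^sub>M count_space UNIV"
      by (auto intro: measurable_arm_history)
    have [measurable]: "num_pulls A i r \<in> history M A Y t \<rightarrow>\<^sub>M count_space UNIV"
      using True by (intro num_pulls_measurable measurable_arm_history)
        (auto elim: order_trans[rotated])
    show ?thesis by measurable
  next
    case False
    then have "?P r = (\<lambda>_. False)" by auto
    then show ?thesis by simp
  qed
  then show "Measurable.pred (history M A Y t) (\<lambda>\<omega>. pull_time A i s \<omega> \<le> t)"
    unfolding le_iff by measurable
qed

context stochastic_bandit
begin

lemma reward_measurable:
  "i \<in> {1..K} \<Longrightarrow> 1 \<le> n \<Longrightarrow> Y i n \<in> borel_measurable M"
  using indep_rewards by (auto simp: indep_vars_def)

lemma observed_reward_measurable: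
  assumes "1 \<le> t"
  shows "observed_reward A Y t \<in> borel_measurable M"
proof -
  note [measurable] = measurable_arm[OF assms]
  have [measurable]: "num_pulls A i t \<in> M \<rightarrow>\<^sub>M count_space UNIV" for i
    by (intro num_pulls_measurable measurable_arm)
  have [measurable]: "Y i n \<in> borel_measurable M" if "i \<in> {1..K}" "n \<in> {1..t}" for i n
    using that by (auto intro: reward_measurable)
  have "num_pulls A (A t \<omega>) t \<omega> \<in> {1..t}" for \<omega>
  proof -
    have "t \<in> {q \<in> {1..t}. A q \<omega> = A t \<omega>}" using assms by simp
    then have "num_pulls A (A t \<omega>) t \<omega> \<noteq> 0" by (auto simp: num_pulls_def)
    moreover have "num_pulls A (A t \<omega>) t \<omega> \<le> card {1..t}"
      unfolding num_pulls_def by (rule card_mono) auto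
    ultimately show ?thesis by simp
  qed
  then have "observed_reward A Y t \<omega> = (\<Sum>i\<in>{1..K}. \<Sum>n\<in>{1..t}.
      if A t \<omega> = i \<and> num_pulls A i t \<omega> = n then Y i n \<omega> else 0)" if "\<omega> \<in> space M" for \<omega>
  proof -
    have "(\<Sum>i\<in>{1..K}. \<Sum>n\<in>{1..t}. if A t \<omega> = i \<and> num_pulls A i t \<omega> = n then Y i n \<omega> else 0)
        = (\<Sum>i\<in>{1..K}. if A t \<omega> = i then (\<Sum>n\<in>{1..t}.
            if num_pulls A (A t \<omega>) t \<omega> = n then Y (A t \<omega>) n \<omega> else 0) else 0)"
      by (intro sum.cong refl) auto
    then show ?thesis
      using \<open>num_pulls A (A t \<omega>) t \<omega> \<in> {1..t}\<close> arm_range[OF assms that]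
      by (simp add: observed_reward_def)
  qed
  then show ?thesis
    by (subst measurable_cong) (assumption, measurable)
qed

lemma subalgebra_history_at_pull: "subalgebra M (history_at_pull M A Y i s)"
proof -
  interpret H: filtration "space M" "history M A Y" by (rule filtration_history)
  have "sets (history M A Y \<infinity>) \<subseteq> sets M"
  proof (rule sets_history_subset)
    fix q :: nat assume "1 \<le> q"
    note [measurable] = measurable_arm[OF this] observed_reward_measurable[OF this]
    show "(\<lambda>\<omega>. (A q \<omega>, observed_reward A Y q \<omega>)) \<in> M \<rightarrow>\<^sub>M count_space UNIV \<Otimes>\<^sub>M borel"
      by measurable
  qed simp
  moreover have "E \<in> sets (history M A Y \<infinity>)" if "E \<in> sets (history_at_pull M A Y i s)" for E
    using H.sets_pre_sigmaD[OF stopping_time_pull_time that[unfolded history_at_pull_def],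
        of \<infinity>] by simp
  ultimately show ?thesis
    by (auto simp: subalgebra_def history_at_pull_def H.space_pre_sigma)
qed

end

end

theory Submission
  imports Defs
begin

text \<open>
  Put \<open>Z = sqrt s * (\<mu> - \<mu>')\<close> with \<open>\<mu>\<close> the mean and \<open>\<mu>'\<close> the empirical mean of arm 1, and
  \<open>d = sqrt s * \<Delta> / 2\<close>. The conditional probability is the standard Gaussian tail \<open>Q (Z - d)\<close>, and
  \<open>1 / Q (Z - d) \<le> 1 + 9 * exp (3/2 * Z\<^sup>2 - d\<^sup>2 / 8)\<close> holds pointwise. By Hoeffding's lemma \<open>Z\<close> is
  sub-Gaussian with variance proxy 1/4, hence \<open>exp (3/2 * Z\<^sup>2)\<close> has expectation at most 2, so that
  the excess over 1 is at most \<open>18 * exp (- s * \<Delta>\<^sup>2 / 32)\<close>. Both claims follow from this bound.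
\<close>

section \<open>Gaussian tail bounds\<close>

lemma nn_integral_normal_density:
  "0 < \<sigma> \<Longrightarrow> (\<integral>\<^sup>+x. ennreal (normal_density \<mu> \<sigma> x) \<partial>lborel) = 1"
  by (simp add: nn_integral_eq_integral)

text \<open>The tail contains an interval of length \<open>\<sigma>\<close> starting at
  \<open>\<mu> + \<sigma> * x\<close>, on which the density is at least its value at the right
  endpoint. There the exponent is \<open>- (x + 1)\<^sup>2 / 2\<close>, which is at least
  \<open>- x\<^sup>2 - 1\<close>. The constant 9 is 3 * 3: one factor bounds \<open>exp 1\<close>,
  the other \<open>sqrt (2 * pi)\<close>.\<close>

lemma normal_upper_tail_ge:
  assumes "0 < \<sigma>" "0 \<le> x" "t \<le> \<mu> + \<sigma> * x"
  shows "ennreal (exp (- x\<^sup>2) / 9) \<le> emeasure (density lborel (normal_density \<mu> \<sigma>)) {t<..}"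
proof -
  let ?I = "{\<mu> + \<sigma> * x<..\<mu> + \<sigma> * (x + 1)}"
  have density_ge: "exp (- x\<^sup>2) / (9 * \<sigma>) \<le> normal_density \<mu> \<sigma> y" if "y \<in> ?I" for y
  proof -
    have "0 \<le> \<sigma> * x" using assms by simp
    then have "(y - \<mu>)\<^sup>2 \<le> (\<sigma> * (x + 1))\<^sup>2"
      using that by (intro power_mono) auto
    also have "\<dots> \<le> \<sigma>\<^sup>2 * (2 * (x\<^sup>2 + 1))"
    proof -
      have "(x + 1)\<^sup>2 \<le> 2 * (x\<^sup>2 + 1)"
        using zero_le_power2[of "x - 1"] by (simp add: power2_eq_square algebra_simps)
      then show ?thesis unfolding power_mult_distrib by (rule mult_left_mono) simp
    qed
    finally have "- x\<^sup>2 - 1 \<le> - (y - \<mu>)\<^sup>2 / (2 * \<sigma>\<^sup>2)"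
      using \<open>0 < \<sigma>\<close> by (simp add: field_simps)
    then have exp_ge: "exp (- x\<^sup>2 - 1) \<le> exp (- (y - \<mu>)\<^sup>2 / (2 * \<sigma>\<^sup>2))" by simp
    have "exp (- x\<^sup>2) / 3 \<le> exp (- x\<^sup>2 - 1)"
      unfolding exp_diff using exp_le by (intro divide_left_mono) auto
    with exp_ge have exp_ge': "exp (- x\<^sup>2) / 3 \<le> exp (- (y - \<mu>)\<^sup>2 / (2 * \<sigma>\<^sup>2))"
      by linarith
    have "2 * pi * \<sigma>\<^sup>2 \<le> (3 * \<sigma>)\<^sup>2"
      using mult_right_mono[of "2 * pi" 9 "\<sigma>\<^sup>2"] pi_less_4 by (simp add: power_mult_distrib)
    then have "sqrt (2 * pi * \<sigma>\<^sup>2) \<le> 3 * \<sigma>"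
      using \<open>0 < \<sigma>\<close> by (intro real_le_lsqrt) auto
    then have "1 / (3 * \<sigma>) \<le> 1 / sqrt (2 * pi * \<sigma>\<^sup>2)"
      using \<open>0 < \<sigma>\<close> by (intro divide_left_mono) auto
    from mult_mono[OF this exp_ge'] show ?thesis
      by (simp add: normal_density_def mult.commute)
  qed
  have "ennreal (exp (- x\<^sup>2) / 9) = ennreal (exp (- x\<^sup>2) / (9 * \<sigma>)) * emeasure lborel ?I"
    using \<open>0 < \<sigma>\<close> by (simp add: ennreal_mult[symmetric] algebra_simps)
  also have "\<dots> = (\<integral>\<^sup>+y\<in>?I. ennreal (exp (- x\<^sup>2) / (9 * \<sigma>)) \<partial>lborel)"
    by (simp add: nn_integral_cmult_indicator)
  also have "\<dots> \<le> (\<integral>\<^sup>+y\<in>{t<..}. ennreal (normal_density \<mu> \<sigma> y) \<partial>lborel)"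
    using density_ge assms(3)
    by (intro nn_integral_mono) (auto intro!: ennreal_leI split: split_indicator)
  also have "\<dots> = emeasure (density lborel (normal_density \<mu> \<sigma>)) {t<..}"
    by (simp add: emeasure_density)
  finally show ?thesis .
qed

text \<open>Recentre the density at the cutoff \<open>\<mu> - \<sigma> * u\<close>. Left of the
  cutoff the cross term in the expanded square has a favourable sign, so the density is at most
  \<open>exp (- u\<^sup>2 / 2)\<close> times the recentred one, whose integral is 1.\<close>

lemma normal_lower_tail_le:
  assumes "0 < \<sigma>" "0 \<le> u"
  shows "emeasure (density lborel (normal_density \<mu> \<sigma>)) {..\<mu> - \<sigma> * u} \<le> ennreal (exp (- u\<^sup>2 / 2))"
proof -
  let ?t = "\<mu> - \<sigma> * u"
  have density_le: "normal_density \<mu> \<sigma> y \<le> exp (- u\<^sup>2 / 2) * normal_density ?t \<sigma> y" if "y \<le> ?t" for y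
  proof -
    have "0 \<le> 2 * (\<sigma> * u) * (?t - y)" using assms that by simp
    then have "(\<sigma> * u)\<^sup>2 + (y - ?t)\<^sup>2 \<le> (y - \<mu>)\<^sup>2"
      by (simp add: power2_eq_square algebra_simps)
    then have "- (y - \<mu>)\<^sup>2 / (2 * \<sigma>\<^sup>2) \<le> - u\<^sup>2 / 2 + - (y - ?t)\<^sup>2 / (2 * \<sigma>\<^sup>2)"
      using \<open>0 < \<sigma>\<close> by (simp add: field_simps)
    then have "exp (- (y - \<mu>)\<^sup>2 / (2 * \<sigma>\<^sup>2)) \<le> exp (- u\<^sup>2 / 2) * exp (- (y - ?t)\<^sup>2 / (2 * \<sigma>\<^sup>2))"
      by (simp only: exp_add[symmetric] exp_le_cancel_iff)
    from mult_left_mono[OF this, of "1 / sqrt (2 * pi * \<sigma>\<^sup>2)"] show ?thesis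
      by (simp add: normal_density_def mult_ac)
  qed
  have "emeasure (density lborel (normal_density \<mu> \<sigma>)) {..?t}
      = (\<integral>\<^sup>+y\<in>{..?t}. ennreal (normal_density \<mu> \<sigma> y) \<partial>lborel)"
    by (simp add: emeasure_density)
  also have "\<dots> \<le> (\<integral>\<^sup>+y. ennreal (exp (- u\<^sup>2 / 2)) * ennreal (normal_density ?t \<sigma> y) \<partial>lborel)"
    using density_le
    by (intro nn_integral_mono) (auto simp: ennreal_mult[symmetric] intro!: ennreal_leI split: split_indicator)
  also have "\<dots> = ennreal (exp (- u\<^sup>2 / 2))"
    using \<open>0 < \<sigma>\<close> by (simp add: nn_integral_cmult nn_integral_normal_density)
  finally show ?thesis .
qed

text \<open>Let \<open>P\<close> be the tail probability and split at \<open>z = d / 2\<close>.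
  Below, the cutoff lies left of the mean, so \<open>P\<close> is at least 1/9; the excess
  \<open>(1 - P) / P\<close> is then at most 9 times the lower tail, which decays in
  \<open>d\<close>. Above, the crude bound \<open>9 * exp (z\<^sup>2)\<close> suffices: since
  \<open>d / 2 < z\<close>, the additional \<open>z\<^sup>2 / 2\<close> in the exponent pays for
  \<open>d\<^sup>2 / 8\<close>.\<close>

lemma inverse_normal_tail_le:
  assumes "0 < \<sigma>" "0 \<le> d"
  shows "1 / emeasure (density lborel (normal_density \<mu> \<sigma>)) {\<mu> + \<sigma> * (z - d)<..}
    \<le> 1 + ennreal (9 * exp (3/2 * z\<^sup>2 - d\<^sup>2 / 8))"
proof -
  interpret N: prob_space "density lborel (normal_density \<mu> \<sigma>)"
    using \<open>0 < \<sigma>\<close> by (rule prob_space_normal_density)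
  let ?t = "\<mu> + \<sigma> * (z - d)"
  define P where "P = N.prob {?t<..}"
  have tail_ge: "exp (- x\<^sup>2) / 9 \<le> P" if "0 \<le> x" "z - d \<le> x" for x
    using normal_upper_tail_ge[of \<sigma> x ?t \<mu>] that \<open>0 < \<sigma>\<close>
    by (simp add: P_def N.emeasure_eq_measure)
  \<comment> \<open>The choice \<open>max 0 (z - d)\<close> is admissible in \<open>tail_ge\<close>
    for every \<open>z\<close>. Positivity lets the \<open>ennreal\<close> quotient be computed as a
    real one.\<close>
  have "0 < P"
    using less_le_trans[OF _ tail_ge[of "max 0 (z - d)"]] by simp
  have "1 / P \<le> 1 + 9 * exp (3/2 * z\<^sup>2 - d\<^sup>2 / 8)"
  proof (cases "z \<le> d / 2")
    case True
    have "1 / 9 \<le> P" using tail_ge[of 0] True assms by simp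
    have "1 - P = N.prob {..?t}"
    proof -
      have "{..?t} = space (density lborel (normal_density \<mu> \<sigma>)) - {?t<..}" by auto
      then show ?thesis unfolding P_def by (simp only:) (subst N.prob_compl, auto)
    qed
    also have "\<dots> \<le> exp (- (d - z)\<^sup>2 / 2)"
      using normal_lower_tail_le[of \<sigma> "d - z" \<mu>] True assms
      by (simp add: N.emeasure_eq_measure algebra_simps)
    also have "\<dots> \<le> exp (3/2 * z\<^sup>2 - d\<^sup>2 / 8)"
    proof -
      have "(d / 2)\<^sup>2 \<le> (d - z)\<^sup>2" using True assms by (intro power_mono) auto
      then have "- (d - z)\<^sup>2 / 2 \<le> - d\<^sup>2 / 8" by (simp add: power_divide)
      moreover have "0 \<le> z\<^sup>2" by simp
      ultimately have "- (d - z)\<^sup>2 / 2 \<le> 3/2 * z\<^sup>2 - d\<^sup>2 / 8" by linarith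
      then show ?thesis by simp
    qed
    finally have le: "1 - P \<le> exp (3/2 * z\<^sup>2 - d\<^sup>2 / 8)" .
    have "1 / P = 1 + (1 - P) / P" using \<open>0 < P\<close> by (simp add: field_simps)
    also have "(1 - P) / P \<le> exp (3/2 * z\<^sup>2 - d\<^sup>2 / 8) / (1 / 9)"
      using le \<open>1 / 9 \<le> P\<close> by (intro frac_le) auto
    finally show ?thesis by simp
  next
    case False
    then have "(d / 2)\<^sup>2 \<le> z\<^sup>2" using assms by (intro power_mono) auto
    then have "z\<^sup>2 \<le> 3/2 * z\<^sup>2 - d\<^sup>2 / 8" by (simp add: power_divide)
    have "exp (- z\<^sup>2) / 9 \<le> P" using tail_ge[of z] False assms by simp
    then have "1 / P \<le> 1 / (exp (- z\<^sup>2) / 9)" using \<open>0 < P\<close> by (intro divide_left_mono) auto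
    also have "\<dots> = 9 * exp (z\<^sup>2)" by (simp add: exp_minus field_simps)
    also have "\<dots> \<le> 9 * exp (3/2 * z\<^sup>2 - d\<^sup>2 / 8)"
      using \<open>z\<^sup>2 \<le> _\<close> by simp
    finally show ?thesis by simp
  qed
  from ennreal_leI[OF this] show ?thesis
    using \<open>0 < P\<close>
    by (simp add: N.emeasure_eq_measure P_def[symmetric] divide_ennreal[symmetric] ennreal_plus)
qed

section \<open>Sub-Gaussian sums of bounded variables\<close>

context interval_bounded_random_variable
begin

text \<open>For positive \<open>l\<close> this is Hoeffding's lemma. A negative \<open>l\<close> is
  reduced to \<open>- l\<close> by passing to \<open>- f\<close>, which lies in the interval from
  \<open>- b\<close> to \<open>- a\<close> of the same length.\<close>

lemma Hoeffdings_lemma_nn_integral_real: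
  "(\<integral>\<^sup>+x. ennreal (exp (l * (f x - expectation f))) \<partial>M) \<le> ennreal (exp (l\<^sup>2 * (b - a)\<^sup>2 / 8))"
proof -
  interpret neg: interval_bounded_random_variable M "\<lambda>x. - f x" "- b" "- a"
    using AE_in_interval by unfold_locales auto
  consider "0 < l" | "l = 0" | "l < 0" by linarith
  then show ?thesis
  proof cases
    case 1
    then show ?thesis by (rule Hoeffdings_lemma_nn_integral)
  next
    case 2
    then show ?thesis by (simp add: emeasure_space_1)
  next
    case 3
    then show ?thesis
      using neg.Hoeffdings_lemma_nn_integral[of "- l"] by (simp add: algebra_simps)
  qed
qed

end

text \<open>Independence turns the expectation of the product of exponentials into a product of
  expectations, and Hoeffding's lemma bounds each factor.\<close>

lemma (in indep_interval_bounded_random_variables) nn_integral_exp_sum_le: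
  "(\<integral>\<^sup>+x. ennreal (exp (l * (\<Sum>i\<in>I. X i x - expectation (X i)))) \<partial>M)
    \<le> ennreal (exp (l\<^sup>2 * (\<Sum>i\<in>I. (b i - a i)\<^sup>2) / 8))"
proof -
  have "(\<integral>\<^sup>+x. ennreal (exp (l * (\<Sum>i\<in>I. X i x - expectation (X i)))) \<partial>M)
      = (\<integral>\<^sup>+x. (\<Prod>i\<in>I. ennreal (exp (l * (X i x - expectation (X i))))) \<partial>M)"
    by (simp add: sum_distrib_left exp_sum fin prod_ennreal)
  also have "\<dots> = (\<Prod>i\<in>I. \<integral>\<^sup>+x. ennreal (exp (l * (X i x - expectation (X i)))) \<partial>M)"
    by (intro indep_vars_nn_integral fin indep_vars_compose2[OF indep]) auto
  also have "\<dots> \<le> (\<Prod>i\<in>I. ennreal (exp (l\<^sup>2 * (b i - a i)\<^sup>2 / 8)))"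
  proof (intro prod_mono_ennreal)
    fix i assume "i \<in> I"
    then interpret interval_bounded_random_variable M "X i" "a i" "b i" ..
    show "(\<integral>\<^sup>+x. ennreal (exp (l * (X i x - expectation (X i)))) \<partial>M)
        \<le> ennreal (exp (l\<^sup>2 * (b i - a i)\<^sup>2 / 8))"
      by (rule Hoeffdings_lemma_nn_integral_real)
  qed
  also have "\<dots> = ennreal (exp (l\<^sup>2 * (\<Sum>i\<in>I. (b i - a i)\<^sup>2) / 8))"
    by (simp add: prod_ennreal exp_sum[symmetric] fin sum_distrib_left sum_divide_distrib)
  finally show ?thesis .
qed

text \<open>
  \<open>exp (c * Z\<^sup>2)\<close> is the average of \<open>exp (sqrt (2 * c) * g * Z)\<close> over a standard Gaussian \<open>g\<close>; exchanging
  the two expectations reduces the claim to the moment generating function of \<open>Z\<close>.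
\<close>

lemma (in prob_space) nn_integral_exp_square_le:
  assumes Z [measurable]: "Z \<in> borel_measurable M"
    and mgf: "\<And>l. (\<integral>\<^sup>+\<omega>. ennreal (exp (l * Z \<omega>)) \<partial>M) \<le> ennreal (exp (v * l\<^sup>2 / 2))"
    and "0 \<le> c" "2 * c * v < 1"
  shows "(\<integral>\<^sup>+\<omega>. ennreal (exp (c * (Z \<omega>)\<^sup>2)) \<partial>M) \<le> ennreal (1 / sqrt (1 - 2 * c * v))"
proof -
  define r where "r = sqrt (2 * c)"
  define w where "w = 1 - 2 * c * v"
  have r: "r\<^sup>2 = 2 * c" using \<open>0 \<le> c\<close> by (simp add: r_def)
  have w: "0 < w" using assms(4) by (simp add: w_def)
  \<comment> \<open>Completing the square in \<open>g\<close>; the choice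
    \<open>r\<^sup>2 = 2 * c\<close> leaves exactly the factor
    \<open>exp (c * z\<^sup>2)\<close>.\<close>
  have average: "std_normal_density g * exp (r * g * z) = exp (c * z\<^sup>2) * normal_density (r * z) 1 g"
    for g z
  proof -
    have "(r * z)\<^sup>2 = 2 * c * z\<^sup>2" by (simp add: power_mult_distrib r)
    then have "- g\<^sup>2 / 2 + r * g * z = c * z\<^sup>2 + - (g - r * z)\<^sup>2 / 2"
      by (simp add: power2_diff field_simps)
    then have "exp (- g\<^sup>2 / 2) * exp (r * g * z) = exp (c * z\<^sup>2) * exp (- (g - r * z)\<^sup>2 / 2)"
      by (simp only: exp_add[symmetric])
    then show ?thesis by (simp add: normal_density_def)
  qed
  \<comment> \<open>After the bound on the moment generating function, the integrand is an
    unnormalised centred Gaussian of variance \<open>1 / w\<close>. It is integrable because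
    \<open>2 * c * v < 1\<close> makes \<open>w\<close> positive.\<close>
  have rescale: "std_normal_density g * exp (v * (r * g)\<^sup>2 / 2)
      = 1 / sqrt w * normal_density 0 (1 / sqrt w) g" for g
  proof -
    have "- g\<^sup>2 / 2 + v * (r * g)\<^sup>2 / 2 = - g\<^sup>2 / (2 * (1 / sqrt w)\<^sup>2)"
      using w by (simp add: power_mult_distrib r power_divide) (simp add: w_def field_simps)
    then have "exp (- g\<^sup>2 / 2) * exp (v * (r * g)\<^sup>2 / 2) = exp (- g\<^sup>2 / (2 * (1 / sqrt w)\<^sup>2))"
      by (simp only: exp_add[symmetric])
    then show ?thesis
      using w by (simp add: normal_density_def power_divide real_sqrt_divide real_sqrt_mult)
  qed
  have "(\<integral>\<^sup>+\<omega>. ennreal (exp (c * (Z \<omega>)\<^sup>2)) \<partial>M)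
      = (\<integral>\<^sup>+\<omega>. (\<integral>\<^sup>+g. ennreal (std_normal_density g * exp (r * g * Z \<omega>)) \<partial>lborel) \<partial>M)"
    by (simp add: average ennreal_mult nn_integral_cmult nn_integral_normal_density)
  also have "\<dots> = (\<integral>\<^sup>+g. (\<integral>\<^sup>+\<omega>. ennreal (std_normal_density g * exp (r * g * Z \<omega>)) \<partial>M) \<partial>lborel)"
  proof -
    interpret pair_sigma_finite M lborel ..
    show ?thesis by (rule Fubini'[symmetric]) measurable
  qed
  also have "\<dots> = (\<integral>\<^sup>+g. ennreal (std_normal_density g) * (\<integral>\<^sup>+\<omega>. ennreal (exp (r * g * Z \<omega>)) \<partial>M) \<partial>lborel)"
    by (simp add: ennreal_mult nn_integral_cmult)
  also have "\<dots> \<le> (\<integral>\<^sup>+g. ennreal (std_normal_density g) * ennreal (exp (v * (r * g)\<^sup>2 / 2)) \<partial>lborel)"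
    by (intro nn_integral_mono mult_left_mono mgf) simp
  also have "\<dots> = (\<integral>\<^sup>+g. ennreal (1 / sqrt w) * ennreal (normal_density 0 (1 / sqrt w) g) \<partial>lborel)"
    using w by (simp only: ennreal_mult[symmetric] normal_density_nonneg rescale exp_ge_zero
        divide_nonneg_nonneg real_sqrt_ge_zero less_imp_le zero_le_one)
  also have "\<dots> = ennreal (1 / sqrt w)"
    using w by (simp add: nn_integral_cmult nn_integral_normal_density)
  finally show ?thesis by (simp add: w_def)
qed

section \<open>Expected inverse probability for the bandit\<close>

text \<open>The scaled deviation is a sum of \<open>s\<close> independent centred rewards of range
  1, each divided by \<open>sqrt s\<close>, so its variance proxy is 1/4 whatever \<open>s\<close>
  is. With \<open>c = 3/2\<close> and \<open>v = 1/4\<close> the value of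
  \<open>1 / sqrt (1 - 2 * c * v)\<close> is 2.\<close>

lemma (in stochastic_bandit) nn_integral_exp_empirical_mean:
  assumes "i \<in> {1..K}" "1 \<le> s"
  shows "(\<integral>\<^sup>+\<omega>. ennreal (exp (3/2 * (sqrt (real s) * (arm_mean p i - empirical_mean Y i s \<omega>))\<^sup>2)) \<partial>M) \<le> 2"
proof -
  have rv [measurable]: "Y i n \<in> borel_measurable M" if "n \<in> {1..s}" for n
    using that assms(1) by (intro reward_measurable) auto
  interpret R: indep_interval_bounded_random_variables M "{1..s}" "Y i" "\<lambda>_. 0" "\<lambda>_. 1"
  proof
    show "indep_vars (\<lambda>_. borel) (Y i) {1..s}"
      by (rule indep_vars_subset[OF indep_rewards]) (use assms in auto)
    show "AE \<omega> in M. Y i n \<omega> \<in> {0..1}" if "n \<in> {1..s}" for n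
    proof -
      have n: "1 \<le> n" using that by simp
      have "AE x in distr M borel (Y i n). x \<in> {0..1}"
        unfolding distr_reward[OF assms(1) n] by (rule support_arm[OF assms(1)])
      then show ?thesis using that by (subst (asm) AE_distr_iff) auto
    qed
  qed simp
  have expectation_reward: "expectation (Y i n) = arm_mean p i" if "n \<in> {1..s}" for n
  proof -
    have "arm_mean p i = (\<integral>x. x \<partial>distr M borel (Y i n))"
      using that assms(1) by (simp add: arm_mean_def distr_reward)
    then show ?thesis using that by (simp add: integral_distr)
  qed
  let ?Z = "\<lambda>\<omega>. sqrt (real s) * (arm_mean p i - empirical_mean Y i s \<omega>)"
  have Z_eq: "?Z \<omega> = - (1 / sqrt (real s)) * (\<Sum>n\<in>{1..s}. Y i n \<omega> - expectation (Y i n))" for \<omega>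
  proof -
    \<comment> \<open>To be used with \<open>q = sqrt s\<close>; writing \<open>q * q\<close> for
      \<open>s\<close> makes this a purely rational identity.\<close>
    have rescale: "q * (m - S / (q * q)) = - (1 / q) * (S - q * q * m)" if "q \<noteq> 0" for q m S :: real
      using that by (simp add: divide_simps)
    have "(\<Sum>n\<in>{1..s}. Y i n \<omega> - expectation (Y i n)) = (\<Sum>n=1..s. Y i n \<omega>) - real s * arm_mean p i"
      by (simp add: sum_subtractf expectation_reward)
    then show ?thesis
      using rescale[of "sqrt (real s)"] assms(2) by (simp add: empirical_mean_def)
  qed
  have "(\<integral>\<^sup>+\<omega>. ennreal (exp (l * ?Z \<omega>)) \<partial>M) \<le> ennreal (exp ((1/4) * l\<^sup>2 / 2))" for l
  proof -
    have "(\<integral>\<^sup>+\<omega>. ennreal (exp (l * ?Z \<omega>)) \<partial>M) = (\<integral>\<^sup>+\<omega>. ennreal (exp ((- l / sqrt (real s)) *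
        (\<Sum>n\<in>{1..s}. Y i n \<omega> - expectation (Y i n)))) \<partial>M)"
      by (simp add: Z_eq)
    also have "\<dots> \<le> ennreal (exp ((- l / sqrt (real s))\<^sup>2 * (\<Sum>n\<in>{1..s}. (1 - 0)\<^sup>2) / 8))"
      by (rule R.nn_integral_exp_sum_le)
    also have "(- l / sqrt (real s))\<^sup>2 * (\<Sum>n\<in>{1..s}. (1 - 0)\<^sup>2) / 8 = (1/4) * l\<^sup>2 / 2"
      using assms(2) by (simp add: power_divide)
    finally show ?thesis .
  qed
  moreover have "?Z \<in> borel_measurable M"
    unfolding empirical_mean_def by measurable
  ultimately have "(\<integral>\<^sup>+\<omega>. ennreal (exp (3/2 * (?Z \<omega>)\<^sup>2)) \<partial>M) \<le> ennreal (1 / sqrt (1 - 2 * (3/2) * (1/4)))"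
    by (intro nn_integral_exp_square_le) auto
  also have "1 / sqrt (1 - 2 * (3/2) * (1/4)) = (2 :: real)"
    by (simp add: real_sqrt_divide)
  finally show ?thesis by simp
qed

text \<open>Almost surely the conditional probability is a Gaussian tail, so the pointwise bound on
  its reciprocal can be integrated. Its prefactor 9 times the exponential moment bound 2 gives
  18.\<close>

lemma (in stochastic_bandit) nn_integral_inverse_cond_prob_le:
  assumes "1 \<le> K" "1 \<le> s" "0 \<le> \<Delta>"
    and theta: "cond_normal M F \<theta> (empirical_mean Y 1 s) (1 / real s)"
  shows "(\<integral>\<^sup>+\<omega>. 1 / cond_prob_given M F {\<omega>\<in>space M. arm_mean p 1 - \<Delta> / 2 < \<theta> \<omega>} \<omega> \<partial>M)
    \<le> 1 + ennreal (18 * exp (- (real s * \<Delta>\<^sup>2 / 32)))"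
proof -
  define Z where "Z \<omega> = sqrt (real s) * (arm_mean p 1 - empirical_mean Y 1 s \<omega>)" for \<omega>
  define \<sigma> where "\<sigma> = sqrt (1 / real s)"
  define d where "d = sqrt (real s) * \<Delta> / 2"
  have "0 < \<sigma>" "0 \<le> d" using assms by (auto simp: \<sigma>_def d_def)
  have \<sigma>_cancel: "\<sigma> * (sqrt (real s) * x) = x" for x
    using assms(2) by (simp add: \<sigma>_def real_sqrt_divide)
  \<comment> \<open>In units of the standard deviation \<open>\<sigma>\<close>, the cutoff lies
    \<open>Z - d\<close> above the empirical mean, the form required by
    \<open>inverse_normal_tail_le\<close>.\<close>
  have threshold: "empirical_mean Y 1 s \<omega> + \<sigma> * (Z \<omega> - d) = arm_mean p 1 - \<Delta> / 2" for \<omega>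
    using \<sigma>_cancel[of "\<Delta> / 2"] by (simp add: right_diff_distrib' \<sigma>_cancel d_def Z_def)
  have [measurable]: "Y 1 n \<in> borel_measurable M" if "n \<in> {1..s}" for n
    using that assms(1) by (intro reward_measurable) auto
  have [measurable]: "Z \<in> borel_measurable M"
    unfolding Z_def[abs_def] empirical_mean_def by measurable
  have "AE \<omega> in M. cond_prob_given M F {\<omega>\<in>space M. arm_mean p 1 - \<Delta> / 2 < \<theta> \<omega>} \<omega>
      = emeasure (density lborel (normal_density (empirical_mean Y 1 s \<omega>) \<sigma>)) {arm_mean p 1 - \<Delta> / 2<..}"
    using theta[unfolded cond_normal_def, THEN conjunct2, rule_format, of "{arm_mean p 1 - \<Delta> / 2<..}"]
    by (simp add: \<sigma>_def)
  then have "(\<integral>\<^sup>+\<omega>. 1 / cond_prob_given M F {\<omega>\<in>space M. arm_mean p 1 - \<Delta> / 2 < \<theta> \<omega>} \<omega> \<partial>M)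
      \<le> (\<integral>\<^sup>+\<omega>. 1 + ennreal (9 * exp (3/2 * (Z \<omega>)\<^sup>2 - d\<^sup>2 / 8)) \<partial>M)"
  proof (intro nn_integral_mono_AE, eventually_elim)
    fix \<omega>
    assume "cond_prob_given M F {\<omega>\<in>space M. arm_mean p 1 - \<Delta> / 2 < \<theta> \<omega>} \<omega>
      = emeasure (density lborel (normal_density (empirical_mean Y 1 s \<omega>) \<sigma>)) {arm_mean p 1 - \<Delta> / 2<..}"
    then show "1 / cond_prob_given M F {\<omega>\<in>space M. arm_mean p 1 - \<Delta> / 2 < \<theta> \<omega>} \<omega>
        \<le> 1 + ennreal (9 * exp (3/2 * (Z \<omega>)\<^sup>2 - d\<^sup>2 / 8))"
      using inverse_normal_tail_le[OF \<open>0 < \<sigma>\<close> \<open>0 \<le> d\<close>, of "empirical_mean Y 1 s \<omega>" "Z \<omega>"]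
      by (simp only: threshold)
  qed
  also have "\<dots> = (\<integral>\<^sup>+\<omega>. 1 + ennreal (9 * exp (- d\<^sup>2 / 8)) * ennreal (exp (3/2 * (Z \<omega>)\<^sup>2)) \<partial>M)"
  proof -
    have "9 * exp (3/2 * x - d\<^sup>2 / 8) = 9 * exp (- d\<^sup>2 / 8) * exp (3/2 * x)" for x
      by (simp add: mult_exp_exp)
    then show ?thesis by (simp only: ennreal_mult exp_ge_zero mult_nonneg_nonneg zero_le_numeral)
  qed
  also have "\<dots> = 1 + ennreal (9 * exp (- d\<^sup>2 / 8)) * (\<integral>\<^sup>+\<omega>. ennreal (exp (3/2 * (Z \<omega>)\<^sup>2)) \<partial>M)"
    by (subst nn_integral_add) (auto simp: nn_integral_cmult emeasure_space_1)
  also have "\<dots> \<le> 1 + ennreal (9 * exp (- d\<^sup>2 / 8)) * 2"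
    using assms unfolding Z_def
    by (intro add_left_mono mult_left_mono nn_integral_exp_empirical_mean) auto
  also have "\<dots> = 1 + ennreal (18 * exp (- d\<^sup>2 / 8))"
    by (simp add: ennreal_mult[of _ 2, simplified, symmetric])
  also have "- d\<^sup>2 / 8 = - (real s * \<Delta>\<^sup>2 / 32)"
    by (simp add: d_def power_mult_distrib power_divide)
  finally show ?thesis .
qed

section \<open>The pull threshold and both claims\<close>

text \<open>The factor 32 matches the decay rate \<open>s * \<Delta>\<^sup>2 / 32\<close>: once
  \<open>s\<close> reaches the threshold, the exponential is at most
  \<open>1 / (T * \<Delta>\<^sup>2 + 1)\<close>. Positivity of the threshold excludes
  \<open>s = 0\<close>.\<close>

lemma pull_threshold_ge:
  assumes "0 < \<Delta>"
  shows "32 * ln (real T * \<Delta>\<^sup>2 + 1) \<le> pull_threshold T \<Delta> * \<Delta>\<^sup>2"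
    and "0 < pull_threshold T \<Delta>"
proof -
  let ?N = "real T * \<Delta>\<^sup>2 + 100 powr (1/3)"
  have "0 \<le> real T * \<Delta>\<^sup>2" by simp
  moreover have "1 < 100 powr (1/3 :: real)" by (simp add: gr_one_powr)
  ultimately have "1 < ?N" by linarith
  then have "0 < ln ?N" by simp
  \<comment> \<open>Replacing \<open>sqrt 3.5\<close> by \<open>sqrt 2\<close> already gives the
    coefficient \<open>(2 * sqrt 2)\<^sup>2 = 8\<close>, and 4 * 8 = 32.\<close>
  have "sqrt 2 \<le> sqrt 3.5" by simp
  then have "(2 * sqrt 2)\<^sup>2 \<le> (sqrt 2 + sqrt 3.5)\<^sup>2" by (intro power_mono) auto
  then have coeff: "8 \<le> (sqrt 2 + sqrt 3.5)\<^sup>2" by simp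
  have "ln (real T * \<Delta>\<^sup>2 + 1) \<le> ln ?N"
    using \<open>0 \<le> real T * \<Delta>\<^sup>2\<close> \<open>1 < 100 powr (1/3 :: real)\<close> by (subst ln_le_cancel_iff) linarith+
  then have "32 * ln (real T * \<Delta>\<^sup>2 + 1) \<le> 4 * 8 * ln ?N" by simp
  also have "\<dots> \<le> 4 * (sqrt 2 + sqrt 3.5)\<^sup>2 * ln ?N"
    using coeff \<open>0 < ln ?N\<close> by (intro mult_right_mono) auto
  finally show "32 * ln (real T * \<Delta>\<^sup>2 + 1) \<le> pull_threshold T \<Delta> * \<Delta>\<^sup>2"
    using assms by (simp add: pull_threshold_def)
  have "0 < (sqrt 2 + sqrt 3.5)\<^sup>2" using coeff by linarith
  then show "0 < pull_threshold T \<Delta>"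
    unfolding pull_threshold_def using \<open>0 < ln ?N\<close> assms
    by (intro divide_pos_pos mult_pos_pos) auto
qed

theorem lemma2:
  fixes M :: "'a measure" and K T i s :: nat and p :: "nat \<Rightarrow> real measure"
    and A :: "nat \<Rightarrow> 'a \<Rightarrow> nat" and Y :: "nat \<Rightarrow> nat \<Rightarrow> 'a \<Rightarrow> real" and \<theta> :: "'a \<Rightarrow> real"
  assumes bandit: "stochastic_bandit M K p A Y"
    and horizon: "1 \<le> T"
    and suboptimal: "i \<in> {1..K}" "0 < gap p i"
    and F: "F = history_at_pull M A Y 1 s"
    and theta: "cond_normal M F \<theta> (empirical_mean Y 1 s) (1 / real s)"
    and E: "E = {\<omega> \<in> space M. \<theta> \<omega> > arm_mean p 1 - gap p i / 2}"
  shows "(1 \<le> s \<longrightarrow> (\<integral>\<^sup>+ \<omega>. 1 / cond_prob_given M F E \<omega> \<partial>M) - 1 \<le> 29)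
    \<and> (pull_threshold T (gap p i) \<le> real s \<longrightarrow>
        (\<integral>\<^sup>+ \<omega>. 1 / cond_prob_given M F E \<omega> \<partial>M) - 1 \<le> ennreal (180 / (real T * (gap p i)\<^sup>2)))"
proof -
  interpret stochastic_bandit M K p A Y by (rule bandit)
  let ?\<Delta> = "gap p i"
  let ?e = "exp (- (real s * ?\<Delta>\<^sup>2 / 32))"
  \<comment> \<open>Both claims are instances, with \<open>c\<close> equal to 29 and to
    \<open>180 / (T * \<Delta>\<^sup>2)\<close>. Subtraction in \<open>ennreal\<close> truncates at
    0, so bounding the integral by \<open>1 + c\<close> is enough.\<close>
  have bound: "(\<integral>\<^sup>+ \<omega>. 1 / cond_prob_given M F E \<omega> \<partial>M) - 1 \<le> ennreal c" if "1 \<le> s" "18 * ?e \<le> c" for c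
  proof -
    have "(\<integral>\<^sup>+ \<omega>. 1 / cond_prob_given M F E \<omega> \<partial>M) \<le> 1 + ennreal (18 * ?e)"
      unfolding E using suboptimal \<open>1 \<le> s\<close> by (intro nn_integral_inverse_cond_prob_le theta) auto
    also have "\<dots> \<le> 1 + ennreal c"
      using that by (intro add_left_mono ennreal_leI)
    finally show ?thesis by (simp add: ennreal_minus_le_iff)
  qed
  have "(\<integral>\<^sup>+ \<omega>. 1 / cond_prob_given M F E \<omega> \<partial>M) - 1 \<le> 29" if "1 \<le> s"
  proof -
    have "?e \<le> 1" by simp
    then have "18 * ?e \<le> 29" by linarith
    from bound[OF that this] show ?thesis by simp
  qed
  moreover have "(\<integral>\<^sup>+ \<omega>. 1 / cond_prob_given M F E \<omega> \<partial>M) - 1 \<le> ennreal (180 / (real T * ?\<Delta>\<^sup>2))"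
    if s: "pull_threshold T ?\<Delta> \<le> real s"
  proof (rule bound)
    have "0 < real s" using pull_threshold_ge(2)[OF suboptimal(2), of T] s by linarith
    then show "1 \<le> s" by simp
    let ?n = "real T * ?\<Delta>\<^sup>2"
    have "0 < ?n" using horizon suboptimal(2) by simp
    have "32 * ln (?n + 1) \<le> real s * ?\<Delta>\<^sup>2"
      using pull_threshold_ge(1)[OF suboptimal(2), of T] mult_right_mono[OF s, of "?\<Delta>\<^sup>2"] by simp
    then have "?e \<le> exp (- ln (?n + 1))" by simp
    also have "\<dots> = 1 / (?n + 1)" using \<open>0 < ?n\<close> by (simp add: exp_minus field_simps)
    \<comment> \<open>The generous numerator 10 turns the factor 18 into the claimed 180.\<close>
    also have "\<dots> \<le> 10 / ?n" using \<open>0 < ?n\<close> by (intro frac_le) auto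
    finally show "18 * ?e \<le> 180 / ?n" by simp
  qed
  ultimately show ?thesis by blast
qed

end
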